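(* Let $q>1$ be real, $\mathcal{L}=\mathbb{H}_L$, and $\mathcal{X}=\{a+b\mathrm{i}+c\mathrm{j}+d\mathrm{k}:a,b,c,d\in[0,1)\}$. Suppose $K_q<\infty$. Let $a_1,a_2,a_3,a_4\in\{0,1,\dots,\lfloor q\rfloor\}$ with $a_i\le d'$ for $1\le i\le4$, and let $\alpha,\beta\in(0,1)$ with $\beta>A_{2q}(\alpha)$ and $\log_q(\alpha\beta)\notin\mathbb{Q}$. Then $\mathcal{C}_q[a_1+a_2\mathrm{i}+a_3\mathrm{j}+a_4\mathrm{k}]$ is $(\alpha,\beta)$-winning.
   Context: $\mathbb{H}$ is the skew field of real quaternions, identified with $\mathbb{R}^4$ with Euclidean norm; $\mathbb{H}_L=\{a+b\mathrm{i}+c\mathrm{j}+d\mathrm{k}:a,b,c,d\in\mathbb{Z}\}$. The $q$-expansion on $\mathcal{X}$: for $z\in\mathcal{X}$, $d(z)$ is the unique element of $\mathcal{L}$ with $qz-d(z)\in\mathcal{X}$, $\mathbb{T}(z)=qz-d(z)$, digits $d_j=d(\mathbb{T}^{j-1}z)$; $\mathcal{C}_q[a]=\{z\in\mathcal{X}:\text{digit }a\text{ appears in the }q\text{-expansion of }z\}$. Real $q$-expansion: for $x\in[0,1)$, $\mathbbm{d}(x)=e_1e_2\cdots$ where $e_j$ is the unique integer in $\{0,\dots,s_q\}$ ($s_q=q-1$ if $q\in\mathbb{N}$, else $\lfloor q\rfloor$) with $q^j(x-\sum_{k\le j}e_kq^{-k})\in[0,1)$. $d'$ is the minimal digit of $\lim_{\varepsilon\to0^+}\mathbbm{d}(1-\varepsilon)$.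 $K_q$: let $i\in\mathbb{N}\cup\{\infty\}$ be the largest index of a nonzero digit in the real $q$-expansion of $q-\lfloor q\rfloor$; $K_q$ is the maximal length of a block of zeros among its first $i$ digits. With $K=K_q$ and $b=2q$, $$A_{2q}(\alpha)=\frac{(2(Kb+2b)+1)\alpha-1}{\alpha[(4(Kb+2b)-1)-\alpha(2(Kb+2b)-1)]}.$$ Schmidt game (played in $\mathcal{X}$ with the Euclidean metric): Alice fixes target $S$; Bob picks initial radius $\rho>0$ and center $x_0$, $B_0=\overline{B(x_0,\rho)}$. With $\rho_n=(\alpha\beta)^n\rho$, for $n\ge1$: Alice picks $y_n$ with $|x_{n-1}-y_n|+\alpha\rho_{n-1}\le\rho_{n-1}$, $A_n=\overline{B(y_n,\alpha\rho_{n-1})}$; Bob picks $x_n$ with $|y_n-x_n|+\rho_n\le\alpha\rho_{n-1}$, $B_n=\overline{B(x_n,\rho_n)}$; outcome $\omega$ is the unique common point; Alice wins iff $\omega\in S$. $S$ is $(\alpha,\beta)$-winning if for every $\rho>0$ Alice has a strategy that wins regardless of Bob's play. *)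

theory Defs
  imports "HOL-Analysis.Analysis" "HOL-Library.Extended_Nat"
begin

text \<open>Quaternions are vectors in \<open>\<real>\<^sup>4\<close>, so that \<open>norm\<close> and \<open>dist\<close> are the Euclidean ones. The
  library product on this type is componentwise; the Hamilton product is \<open>qmult\<close>.\<close>

type_synonym quat = "real ^ 4"

definition Quat :: "real \<Rightarrow> real \<Rightarrow> real \<Rightarrow> real \<Rightarrow> quat" where
  "Quat a b c d = vector [a, b, c, d]"

definition qmult :: "quat \<Rightarrow> quat \<Rightarrow> quat" where
  "qmult x y = Quat
     (x$1 * y$1 - x$2 * y$2 - x$3 * y$3 - x$4 * y$4)
     (x$1 * y$2 + x$2 * y$1 + x$3 * y$4 - x$4 * y$3)
     (x$1 * y$3 - x$2 * y$4 + x$3 * y$1 + x$4 * y$2)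
     (x$1 * y$4 + x$2 * y$3 - x$3 * y$2 + x$4 * y$1)"

definition quat_of_real :: "real \<Rightarrow> quat" where
  "quat_of_real r = Quat r 0 0 0"

lemma Quat_nth [simp]:
  "Quat a b c d $ 1 = a" "Quat a b c d $ 2 = b" "Quat a b c d $ 3 = c" "Quat a b c d $ 4 = d"
  by (simp_all add: Quat_def vector_def)

lemma qmult_of_real: "qmult (quat_of_real r) z = r *\<^sub>R z"
  by (simp add: qmult_def quat_of_real_def vec_eq_iff forall_4)

definition lipschitz_quat :: "quat set" where
  "lipschitz_quat = {Quat (of_int a) (of_int b) (of_int c) (of_int d) | a b c d :: int. True}"

definition unit_cube :: "quat set" where
  "unit_cube = {Quat a b c d | a b c d.
     a \<in> {0..<1} \<and> b \<in> {0..<1} \<and> c \<in> {0..<1} \<and> d \<in> {0..<1}}"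

definition lead_digit :: "quat set \<Rightarrow> quat set \<Rightarrow> quat \<Rightarrow> quat \<Rightarrow> quat" where
  "lead_digit L X q z = (THE d. d \<in> L \<and> qmult q z - d \<in> X)"

definition shift_map :: "quat set \<Rightarrow> quat set \<Rightarrow> quat \<Rightarrow> quat \<Rightarrow> quat" where
  "shift_map L X q z = qmult q z - lead_digit L X q z"

definition expansion_digit :: "quat set \<Rightarrow> quat set \<Rightarrow> quat \<Rightarrow> quat \<Rightarrow> nat \<Rightarrow> quat" where
  "expansion_digit L X q z j = lead_digit L X q ((shift_map L X q ^^ (j - 1)) z)"

definition digit_appears :: "quat set \<Rightarrow> quat set \<Rightarrow> quat \<Rightarrow> quat \<Rightarrow> quat set" where
  "digit_appears L X q a = {z \<in> X. \<exists>j\<ge>1. expansion_digit L X q z j = a}"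


definition max_digit :: "real \<Rightarrow> int" where
  "max_digit q = (if q \<in> \<nat> then \<lfloor>q\<rfloor> - 1 else \<lfloor>q\<rfloor>)"

text \<open>Real digit strings are indexed from 0: entry \<open>j\<close> is the digit \<open>e\<close> with index \<open>j + 1\<close>.\<close>

definition real_q_expansion :: "real \<Rightarrow> real \<Rightarrow> nat \<Rightarrow> int" where
  "real_q_expansion q x = (THE e. \<forall>j. e j \<in> {0..max_digit q} \<and>
     q ^ (j + 1) * (x - (\<Sum>k\<le>j. of_int (e k) / q ^ (k + 1))) \<in> {0..<1})"

text \<open>Convergence of digit strings is digitwise, each digit being eventually constant
  (the topology of \<open>int\<close> is discrete).\<close>

definition left_limit_expansion_at_1 :: "real \<Rightarrow> nat \<Rightarrow> int" where
  "left_limit_expansion_at_1 q j = Lim (at_right 0) (\<lambda>\<epsilon>. real_q_expansion q (1 - \<epsilon>) j)"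

definition min_limit_digit :: "real \<Rightarrow> int" where
  "min_limit_digit q = Min (range (left_limit_expansion_at_1 q))"

text \<open>For \<open>q \<in> \<nat>\<close> all digits of \<open>q - \<lfloor>q\<rfloor> = 0\<close> vanish; then \<open>last_nonzero_index\<close> is \<open>Sup {} = 0\<close>,
  and so is \<open>K_zeros\<close>.\<close>

definition last_nonzero_index :: "real \<Rightarrow> enat" where
  "last_nonzero_index q = Sup {enat (j + 1) | j. real_q_expansion q (q - of_int \<lfloor>q\<rfloor>) j \<noteq> 0}"

definition K_zeros :: "real \<Rightarrow> enat" where
  "K_zeros q = Sup {enat l | l. \<exists>m. enat (m + l) \<le> last_nonzero_index q \<and>
     (\<forall>j\<in>{m..<m + l}. real_q_expansion q (q - of_int \<lfloor>q\<rfloor>) j = 0)}"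

definition A_2q :: "real \<Rightarrow> real \<Rightarrow> real" where
  "A_2q q \<alpha> = (let K = real (the_enat (K_zeros q)); b = 2 * q in
     ((2 * (K * b + 2 * b) + 1) * \<alpha> - 1) /
     (\<alpha> * ((4 * (K * b + 2 * b) - 1) - \<alpha> * (2 * (K * b + 2 * b) - 1))))"


text \<open>A strategy \<open>\<sigma>\<close> of Alice maps the list \<open>[x\<^sub>0, \<dots>, x\<^sub>n\<^sub>-\<^sub>1]\<close> of Bob's previous centers to her
  \<open>n\<close>-th center \<open>y\<^sub>n\<close>, for \<open>n \<ge> 1\<close>; her own earlier moves are determined by it.\<close>

definition game_radius :: "real \<Rightarrow> real \<Rightarrow> real \<Rightarrow> nat \<Rightarrow> real" where
  "game_radius \<alpha> \<beta> \<rho> n = (\<alpha> * \<beta>) ^ n * \<rho>"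

definition alice_move :: "('a list \<Rightarrow> 'a) \<Rightarrow> (nat \<Rightarrow> 'a) \<Rightarrow> nat \<Rightarrow> 'a" where
  "alice_move \<sigma> x n = \<sigma> (map x [0..<n])"

definition alice_legal ::
  "'a::metric_space set \<Rightarrow> real \<Rightarrow> real \<Rightarrow> real \<Rightarrow> ('a list \<Rightarrow> 'a) \<Rightarrow> (nat \<Rightarrow> 'a) \<Rightarrow> nat \<Rightarrow> bool" where
  "alice_legal X \<alpha> \<beta> \<rho> \<sigma> x n \<longleftrightarrow>
     alice_move \<sigma> x n \<in> X \<and>
     dist (x (n - 1)) (alice_move \<sigma> x n) + \<alpha> * game_radius \<alpha> \<beta> \<rho> (n - 1)
       \<le> game_radius \<alpha> \<beta> \<rho> (n - 1)"

definition bob_legal ::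
  "'a::metric_space set \<Rightarrow> real \<Rightarrow> real \<Rightarrow> real \<Rightarrow> ('a list \<Rightarrow> 'a) \<Rightarrow> (nat \<Rightarrow> 'a) \<Rightarrow> nat \<Rightarrow> bool" where
  "bob_legal X \<alpha> \<beta> \<rho> \<sigma> x n \<longleftrightarrow>
     x n \<in> X \<and>
     (n \<ge> 1 \<longrightarrow> dist (alice_move \<sigma> x n) (x n) + game_radius \<alpha> \<beta> \<rho> n
                  \<le> \<alpha> * game_radius \<alpha> \<beta> \<rho> (n - 1))"

text \<open>The balls are those of the metric space \<open>X\<close>. If \<open>X\<close> is not complete they may have no common
  point (their centers converge to a point outside \<open>X\<close>); such a play is not won by Alice.\<close>

definition alice_wins :: "'a::metric_space set \<Rightarrow> real \<Rightarrow> real \<Rightarrow> real \<Rightarrow> 'a set \<Rightarrow> (nat \<Rightarrow> 'a) \<Rightarrow> bool" where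
  "alice_wins X \<alpha> \<beta> \<rho> S x \<longleftrightarrow>
     (\<exists>\<omega>\<in>S. (\<Inter>n. cball (x n) (game_radius \<alpha> \<beta> \<rho> n) \<inter> X) = {\<omega>})"

text \<open>Alice has to answer legally after every finite legal play of Bob; it would not do to ask this
  only for infinite legal plays, since an illegal move of hers may leave Bob without a legal one.\<close>

definition winning :: "'a::metric_space set \<Rightarrow> real \<Rightarrow> real \<Rightarrow> 'a set \<Rightarrow> bool" where
  "winning X \<alpha> \<beta> S \<longleftrightarrow> (\<forall>\<rho>>0. \<exists>\<sigma>. \<forall>x.
     (\<forall>n\<ge>1. (\<forall>m<n. bob_legal X \<alpha> \<beta> \<rho> \<sigma> x m) \<longrightarrow> alice_legal X \<alpha> \<beta> \<rho> \<sigma> x n) \<and>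
     ((\<forall>m. bob_legal X \<alpha> \<beta> \<rho> \<sigma> x m) \<longrightarrow> alice_wins X \<alpha> \<beta> \<rho> S x))"

end

theory Submission
  imports Defs
begin

text \<open>Since \<open>q\<close> is real, the expansion acts on each coordinate by \<open>x \<mapsto> q x mod 1\<close>. The right ends of
  full cylinders of order \<open>j\<close> (intervals of length \<open>q\<^sup>-\<^sup>j\<close> mapped onto \<open>[0,1)\<close>) are followed by gaps of
  length at most \<open>(K + 1) q\<^sup>-\<^sup>j\<close>, because a long run of short cylinders would produce a long block of
  zeros in the expansion of \<open>q - \<lfloor>q\<rfloor>\<close>. Every digit below \<open>\<lfloor>q\<rfloor>\<close> occupies an interval of length
  \<open>q\<^sup>-\<^sup>j\<^sup>-\<^sup>1\<close> inside each full cylinder, and \<open>d' < \<lfloor>q\<rfloor>\<close>. Hence Alice can move to a point \<open>p\<close> such that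
  a ball around \<open>p\<close> lies in the target, as soon as the current radius has the right size relative to
  some \<open>q\<^sup>-\<^sup>j\<close>; by irrationality of \<open>log q (\<alpha> \<beta>)\<close> she only has to wait for this. Afterwards she always
  moves towards \<open>p\<close>, and \<open>\<beta> > A_2q q \<alpha>\<close> says exactly that Bob cannot drive the outcome out of the ball.\<close>

section \<open>The map \<open>x \<mapsto> q x mod 1\<close> and its full cylinders\<close>

definition q_map :: "real \<Rightarrow> real \<Rightarrow> real" where
  "q_map q x = frac (q * x)"

definition left_q_map :: "real \<Rightarrow> real \<Rightarrow> real" where
  "left_q_map q t = q * t - of_int (\<lceil>q * t\<rceil> - 1)"

text \<open>The orbit of \<open>1\<close> under the left-continuous version of \<open>q_map\<close>; its members are the possible
  lengths of a cylinder of order \<open>j\<close>, up to the factor \<open>q\<^sup>-\<^sup>j\<close>.\<close>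

definition left_orbit :: "real \<Rightarrow> nat \<Rightarrow> real" where
  "left_orbit q k = (left_q_map q ^^ k) 1"

text \<open>Digits are not recorded: it is enough that the \<open>j\<close>-th iterate is linear
  with slope \<open>q ^ j\<close> on the interval and starts from the value 0. The scaled length
  \<open>t\<close> is then also the right end of the image.\<close>

definition cylinder :: "real \<Rightarrow> nat \<Rightarrow> real \<Rightarrow> real \<Rightarrow> bool" where
  "cylinder q j u t \<longleftrightarrow> 0 \<le> u \<and> u + t / q ^ j \<le> 1 \<and>
     (\<forall>x. 0 \<le> x \<and> x < t / q ^ j \<longrightarrow> (q_map q ^^ j) (u + x) = q ^ j * x)"

abbreviation full_cylinder :: "real \<Rightarrow> nat \<Rightarrow> real \<Rightarrow> bool" where
  "full_cylinder q j u \<equiv> cylinder q j u 1"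

locale q_expansion =
  fixes q :: real
  assumes q_gt_1: "q > 1"
begin

lemma q_pos: "q > 0"
  using q_gt_1 by simp

lemma left_orbit_0: "left_orbit q 0 = 1"
  by (simp add: left_orbit_def)

lemma left_orbit_Suc: "left_orbit q (Suc k) = q * left_orbit q k - of_int (\<lceil>q * left_orbit q k\<rceil> - 1)"
  by (simp add: left_orbit_def left_q_map_def)

lemma left_orbit_bounds: "0 < left_orbit q k" "left_orbit q k \<le> 1"
proof -
  have "0 < left_orbit q k \<and> left_orbit q k \<le> 1"
  proof (cases k)
    case 0
    then show ?thesis by (simp add: left_orbit_0)
  next
    case (Suc m)
    then show ?thesis unfolding Suc left_orbit_Suc by linarith
  qed
  then show "0 < left_orbit q k" "left_orbit q k \<le> 1" by auto
qed

lemma q_map_funpow_Suc: "(q_map q ^^ Suc j) x = frac (q * (q_map q ^^ j) x)"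
  by (simp add: q_map_def)

lemma full_cylinder_0: "full_cylinder q 0 0"
  by (simp add: cylinder_def)

text \<open>Appending the digit \<open>d\<close>: the bound on \<open>d + s\<close> keeps the
  subinterval inside the parent, and \<open>s \<le> 1\<close> prevents a carry. Full children arise
  for \<open>s = 1\<close>, the last child for \<open>s\<close> from the left orbit.\<close>

lemma cylinder_child:
  assumes "cylinder q j u t" "0 \<le> d" "of_int d + s \<le> q * t" "0 < s" "s \<le> 1"
  shows "cylinder q (Suc j) (u + of_int d / q ^ Suc j) s"
  unfolding cylinder_def
proof (intro conjI allI impI)
  have qj: "q ^ j > 0" "q ^ Suc j > 0"
    using q_pos by auto
  show "0 \<le> u + of_int d / q ^ Suc j"
    using assms qj by (simp add: cylinder_def)
  have end_le: "(of_int d + s) / q ^ Suc j \<le> t / q ^ j"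
  proof -
    have "(of_int d + s) / q ^ Suc j \<le> q * t / q ^ Suc j"
      using assms(3) qj by (intro divide_right_mono) auto
    then show ?thesis using q_pos by simp
  qed
  then show "u + of_int d / q ^ Suc j + s / q ^ Suc j \<le> 1"
    using assms(1) by (simp add: cylinder_def add_divide_distrib)
  fix x assume x: "0 \<le> x \<and> x < s / q ^ Suc j"
  let ?y = "of_int d / q ^ Suc j + x"
  have "0 \<le> ?y"
    using x assms(2) qj by simp
  moreover have "?y < t / q ^ j"
    using x end_le by (simp add: add_divide_distrib)
  ultimately have "(q_map q ^^ j) (u + ?y) = q ^ j * ?y"
    using assms(1) by (simp add: cylinder_def)
  then have "(q_map q ^^ Suc j) (u + ?y) = frac (q * (q ^ j * ?y))"
    by (simp add: q_map_def)
  also have "q * (q ^ j * ?y) = q ^ Suc j * x + of_int d"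
    using q_pos by (simp add: field_simps)
  also have "frac \<dots> = frac (q ^ Suc j * x)"
    by simp
  also have "\<dots> = q ^ Suc j * x"
  proof -
    have "q ^ Suc j * x < 1"
      using x qj assms(5) by (simp add: field_simps)
    then show ?thesis
      using x qj by (simp add: frac_eq)
  qed
  finally show "(q_map q ^^ Suc j) (u + of_int d / q ^ Suc j + x) = q ^ Suc j * x"
    by (simp add: add.assoc)
qed

section \<open>Rightmost descendants and the gaps between full cylinders\<close>

text \<open>The left end of the rightmost cylinder of order \<open>j + l\<close> in the full
  cylinder at \<open>v\<close>, computed from the right end, which all these descendants
  share.\<close>

definition last_descendant :: "nat \<Rightarrow> real \<Rightarrow> nat \<Rightarrow> real" where
  "last_descendant j v l = v + 1 / q ^ j - left_orbit q l / q ^ (j + l)"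

lemma last_descendant_0: "last_descendant j v 0 = v"
  by (simp add: last_descendant_def left_orbit_0)

lemma last_descendant_Suc:
  "last_descendant j v (Suc l) =
     last_descendant j v l + of_int (\<lceil>q * left_orbit q l\<rceil> - 1) / q ^ Suc (j + l)"
  using q_pos by (simp add: last_descendant_def left_orbit_Suc field_simps)

lemma cylinder_last_descendant:
  assumes "full_cylinder q j v"
  shows "cylinder q (j + l) (last_descendant j v l) (left_orbit q l)"
proof (induction l)
  case 0
  then show ?case using assms by (simp add: last_descendant_0 left_orbit_0)
next
  case (Suc l)
  have "0 < q * left_orbit q l"
    using left_orbit_bounds[of l] q_pos by simp
  then have "0 \<le> \<lceil>q * left_orbit q l\<rceil> - 1"
    by linarith
  then have "cylinder q (Suc (j + l)) (last_descendant j v (Suc l)) (left_orbit q (Suc l))"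
    unfolding last_descendant_Suc
    by (intro cylinder_child[OF Suc] left_orbit_bounds) (simp_all add: left_orbit_Suc)
  then show ?case by simp
qed

text \<open>Only the last child of a cylinder can fail to be full: a digit \<open>d\<close> below
  the last one satisfies \<open>d + 1 < q * t\<close>, where \<open>t\<close> is the scaled length
  of the parent.\<close>

lemma full_sibling:
  assumes "full_cylinder q j v" "0 \<le> d" "d < \<lceil>q * left_orbit q l\<rceil> - 1"
  shows "full_cylinder q (Suc (j + l)) (last_descendant j v l + of_int d / q ^ Suc (j + l))"
proof (rule cylinder_child[OF cylinder_last_descendant[OF assms(1)] assms(2)])
  show "of_int d + 1 \<le> q * left_orbit q l"
    using assms(3) by linarith
qed auto

text \<open>A cylinder whose parent has only one child carries a digit \<open>0\<close>; at most \<open>K\<close> such steps separate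
  a cylinder that is not full from an ancestor with a full left sibling.\<close>

lemma full_cylinder_near_right_end:
  assumes K: "\<And>k. 1 \<le> q ^ (K + 1) * left_orbit q k"
    and "full_cylinder q j v"
  shows "\<exists>u. full_cylinder q (j + l) u \<and> u \<le> last_descendant j v l \<and>
    v + 1 / q ^ j \<le> u + (1 + real (min l (K + 1))) / q ^ (j + l)"
  using assms(2)
proof (induction l arbitrary: j v rule: less_induct)
  case (less l)
  have qj: "q ^ i > 0" for i
    using q_pos by simp
  have right_end: "v + 1 / q ^ j = last_descendant j v l + left_orbit q l / q ^ (j + l)"
    by (simp add: last_descendant_def)
  show ?case
  proof (cases "left_orbit q l = 1")
    case True
    have "1 / q ^ (j + l) \<le> (1 + real (min l (K + 1))) / q ^ (j + l)"
      using qj by (intro divide_right_mono) (auto simp: less_imp_le)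
    then show ?thesis
      using cylinder_last_descendant[OF less.prems, of l] True right_end by auto
  next
    case False
    then have "l > 0"
      using left_orbit_0 by (cases l) auto
    \<comment> \<open>The last step before \<open>l\<close> at which the rightmost cylinder has at
      least two children. After it the only digit is 0, so left ends stay fixed and scaled lengths
      are multiplied by \<open>q\<close>.\<close>
    let ?P = "\<lambda>m. m < l \<and> 1 < q * left_orbit q m"
    define m where "m = (GREATEST m. ?P m)"
    have P0: "?P 0"
      using \<open>l > 0\<close> q_gt_1 by (simp add: left_orbit_0)
    have m: "?P m"
      unfolding m_def by (rule GreatestI_nat[where P = ?P and b = l, OF P0]) auto
    have after_m: "q * left_orbit q i \<le> 1" if "m < i" "i < l" for i
    proof (rule ccontr)
      assume "\<not> ?thesis"
      then have "i \<le> m"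
        unfolding m_def using that by (intro Greatest_le_nat[where b = l]) auto
      then show False using that by simp
    qed
    have zeros: "left_orbit q (Suc m + i) = q ^ i * left_orbit q (Suc m) \<and>
        last_descendant j v (Suc m + i) = last_descendant j v (Suc m)" if "Suc m + i \<le> l" for i
      using that
    proof (induction i)
      case (Suc i)
      have "\<lceil>q * left_orbit q (Suc m + i)\<rceil> = 1"
        using after_m[of "Suc m + i"] Suc.prems left_orbit_bounds(1)[of "Suc m + i"] q_pos
        by (intro ceiling_unique) auto
      then show ?case
        using Suc left_orbit_Suc[of "Suc m + i"] last_descendant_Suc[of j v "Suc m + i"] by simp
    qed simp
    define l' where "l' = l - Suc m"
    have l: "l = Suc m + l'" "l' < l"
      using m by (auto simp: l'_def)
    have "l' \<le> K"
    proof -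
      have "q ^ l' * left_orbit q (Suc m) < 1"
        using zeros[of l'] l False left_orbit_bounds(2)[of l] by simp
      also have "1 \<le> q ^ (K + 1) * left_orbit q (Suc m)"
        by (rule K)
      finally have "q ^ l' < q ^ (K + 1)"
        using left_orbit_bounds(1)[of "Suc m"] by simp
      then have "l' < K + 1"
        by (rule power_less_imp_less_exp[OF q_gt_1])
      then show ?thesis by simp
    qed
    \<comment> \<open>\<open>d\<close> is the last digit. The cylinder \<open>w\<close> of digit
      \<open>d - 1\<close> is full and ends exactly where the last descendant of order
      \<open>j + l\<close> begins, so the induction continues in \<open>w\<close> with
      \<open>l'\<close> levels.\<close>
    define d where "d = \<lceil>q * left_orbit q m\<rceil> - 1"
    define w where "w = last_descendant j v m + of_int (d - 1) / q ^ Suc (j + m)"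
    have "d \<ge> 1"
      using m unfolding d_def by linarith
    then have w: "full_cylinder q (Suc (j + m)) w"
      unfolding w_def by (intro full_sibling[OF less.prems]) (auto simp: d_def)
    have w_end: "w + 1 / q ^ Suc (j + m) = last_descendant j v l"
      using zeros[of l'] l last_descendant_Suc[of j v m]
      by (simp add: w_def d_def diff_divide_distrib)
    have jl: "Suc (j + m) + l' = j + l"
      using l by simp
    obtain u where u: "full_cylinder q (j + l) u" "u \<le> last_descendant (Suc (j + m)) w l'"
      "w + 1 / q ^ Suc (j + m) \<le> u + (1 + real (min l' (K + 1))) / q ^ (j + l)"
      using less.IH[OF l(2) w] unfolding jl by blast
    have "0 \<le> left_orbit q l' / q ^ (j + l)"
      using left_orbit_bounds(1)[of l'] qj[of "j + l"] by simp
    then have "last_descendant (Suc (j + m)) w l' \<le> last_descendant j v l"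
      using w_end unfolding last_descendant_def[of "Suc (j + m)"] jl by linarith
    moreover have "v + 1 / q ^ j \<le> u + (1 + real (min l (K + 1))) / q ^ (j + l)"
    proof -
      have "left_orbit q l / q ^ (j + l) \<le> 1 / q ^ (j + l)"
        using left_orbit_bounds(2)[of l] qj[of "j + l"] by (intro divide_right_mono) auto
      then have "v + 1 / q ^ j \<le> u + (1 + real (min l' (K + 1)) + 1) / q ^ (j + l)"
        using right_end w_end u(3) by (simp add: add_divide_distrib)
      \<comment> \<open>The last descendant has cost one more length \<open>1 / q ^ (j + l)\<close>.
        As \<open>l' \<le> K\<close> and \<open>l' < l\<close>, the count stays within
        \<open>min l (K + 1)\<close>.\<close>
      also have "\<dots> \<le> u + (1 + real (min l (K + 1))) / q ^ (j + l)"
        using \<open>l' \<le> K\<close> l qj[of "j + l"] by (intro add_left_mono divide_right_mono) auto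
      finally show ?thesis .
    qed
    ultimately show ?thesis
      using u by fastforce
  qed
qed

text \<open>Take the full cylinder of largest order \<open>i \<le> j\<close> that contains
  \<open>y\<close>. Below it \<open>y\<close> always lies in the last child, for otherwise a full
  sibling of higher order would contain it. So \<open>y\<close> lies between the start of the last
  descendant of order \<open>j\<close> and the common right end, and
  \<open>full_cylinder_near_right_end\<close> applies.\<close>

lemma full_cylinder_before:
  assumes K: "\<And>k. 1 \<le> q ^ (K + 1) * left_orbit q k"
    and y: "0 \<le> y" "y < 1"
  shows "\<exists>u. full_cylinder q j u \<and> u \<le> y \<and> y \<le> u + (real K + 2) / q ^ j"
proof -
  have qj: "q ^ i > 0" for i
    using q_pos by simp
  let ?P = "\<lambda>i. i \<le> j \<and> (\<exists>v. full_cylinder q i v \<and> v \<le> y \<and> y < v + 1 / q ^ i)"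
  define i where "i = (GREATEST i. ?P i)"
  have "?P 0"
    using full_cylinder_0 y by (intro conjI exI[of _ 0]) auto
  then have "?P i"
    unfolding i_def by (rule GreatestI_nat[where b = j]) auto
  then obtain v where "i \<le> j" and v: "full_cylinder q i v" "v \<le> y" "y < v + 1 / q ^ i"
    by blast
  have max: "\<not> ?P k" if "i < k" for k
  proof
    assume "?P k"
    then have "k \<le> i"
      unfolding i_def by (rule Greatest_le_nat[where b = j]) auto
    then show False using that by simp
  qed
  have descend: "last_descendant i v m \<le> y" if "i + m \<le> j" for m
    using that
  proof (induction m)
    case 0
    then show ?case using v by (simp add: last_descendant_0)
  next
    case (Suc m)
    let ?D = "\<lceil>q * left_orbit q m\<rceil> - 1" and ?Q = "q ^ Suc (i + m)"
    show ?case
    proof (rule ccontr)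
      assume "\<not> ?thesis"
      then have less: "y - last_descendant i v m < of_int ?D / ?Q"
        by (simp add: last_descendant_Suc)
      \<comment> \<open>The digit of the child that contains \<open>y\<close>; it is below the last
        digit, hence that child is full.\<close>
      define d where "d = \<lfloor>(y - last_descendant i v m) * ?Q\<rfloor>"
      have nn: "0 \<le> (y - last_descendant i v m) * ?Q"
        using Suc qj[of "Suc (i + m)"] by (intro mult_nonneg_nonneg) auto
      have "(y - last_descendant i v m) * ?Q < of_int ?D"
        using less qj[of "Suc (i + m)"] by (subst (asm) pos_less_divide_eq) auto
      then have d: "0 \<le> d" "d < ?D"
        using nn unfolding d_def by linarith+
      let ?w = "last_descendant i v m + of_int d / ?Q"
      have "of_int d \<le> (y - last_descendant i v m) * ?Q"
        "(y - last_descendant i v m) * ?Q < of_int d + 1"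
        unfolding d_def by linarith+
      then have "of_int d / ?Q \<le> y - last_descendant i v m"
        "y - last_descendant i v m < (of_int d + 1) / ?Q"
        using pos_divide_le_eq[OF qj] pos_less_divide_eq[OF qj] by blast+
      then have "?w \<le> y" "y < ?w + 1 / ?Q"
        by (auto simp: add_divide_distrib)
      with full_sibling[OF v(1) d] have "?P (Suc (i + m))"
        using Suc.prems by auto
      moreover have "\<not> ?P (Suc (i + m))"
        by (rule max) simp
      ultimately show False by blast
    qed
  qed
  define l where "l = j - i"
  have j: "j = i + l"
    using \<open>i \<le> j\<close> by (simp add: l_def)
  obtain u where u: "full_cylinder q j u" "u \<le> last_descendant i v l"
    "v + 1 / q ^ i \<le> u + (1 + real (min l (K + 1))) / q ^ j"
    using full_cylinder_near_right_end[OF K v(1), of l] unfolding j by blast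
  have "(1 + real (min l (K + 1))) / q ^ j \<le> (real K + 2) / q ^ j"
    using qj[of j] by (intro divide_right_mono) auto
  then show ?thesis
    using u v descend[of l] j by (intro exI[of _ u]) auto
qed

section \<open>Real digit strings\<close>

lemma q_map_bounds:
  assumes "0 \<le> x" "x < 1"
  shows "0 \<le> (q_map q ^^ j) x" "(q_map q ^^ j) x < 1"
  using assms by (cases j; simp add: q_map_def frac_lt_1)+

lemma q_map_remainder:
  "q ^ j * (x - (\<Sum>k<j. of_int \<lfloor>q * (q_map q ^^ k) x\<rfloor> / q ^ (k + 1))) = (q_map q ^^ j) x"
proof (induction j)
  case (Suc j)
  let ?S = "x - (\<Sum>k<j. of_int \<lfloor>q * (q_map q ^^ k) x\<rfloor> / q ^ (k + 1))"
  have "q ^ Suc j * (?S - of_int \<lfloor>q * (q_map q ^^ j) x\<rfloor> / q ^ (j + 1)) =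
      q * (q ^ j * ?S) - of_int \<lfloor>q * (q_map q ^^ j) x\<rfloor>"
    using q_pos by (simp add: right_diff_distrib)
  then show ?case
    unfolding Suc q_map_funpow_Suc by (simp add: frac_def diff_diff_eq)
qed simp

text \<open>The scaled remainder after \<open>j\<close> greedy digits is the \<open>j\<close>-th
  iterate (\<open>q_map_remainder\<close>). Conversely, once the earlier digits agree, a remainder
  in [0,1) forces the next digit to be this floor.\<close>

lemma real_q_expansion_eq:
  assumes x: "0 \<le> x" "x < 1"
  shows "real_q_expansion q x = (\<lambda>j. \<lfloor>q * (q_map q ^^ j) x\<rfloor>)"
  unfolding real_q_expansion_def
proof (rule the_equality, intro allI conjI)
  fix j
  have T: "0 \<le> (q_map q ^^ j) x" "(q_map q ^^ j) x < 1"
    using q_map_bounds[OF x] by auto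
  then have less: "q * (q_map q ^^ j) x < q" and ge: "0 \<le> q * (q_map q ^^ j) x"
    using q_pos by auto
  have "\<lfloor>q * (q_map q ^^ j) x\<rfloor> \<le> max_digit q"
  \<comment> \<open>For integer \<open>q\<close> the strict bound excludes the digit
    \<open>q\<close> itself.\<close>
  proof (cases "q \<in> \<nat>")
    case True
    then obtain n where "q = of_nat n" by (auto simp: Nats_def)
    then have "of_int \<lfloor>q\<rfloor> = q" by simp
    then have "\<lfloor>q * (q_map q ^^ j) x\<rfloor> < \<lfloor>q\<rfloor>" using less by linarith
    then show ?thesis using True by (simp add: max_digit_def)
  next
    case False
    then show ?thesis using less unfolding max_digit_def by (simp add: floor_mono)
  qed
  then show "\<lfloor>q * (q_map q ^^ j) x\<rfloor> \<in> {0..max_digit q}"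
    using ge by simp
  show "q ^ (j + 1) * (x - (\<Sum>k\<le>j. of_int \<lfloor>q * (q_map q ^^ k) x\<rfloor> / q ^ (k + 1))) \<in> {0..<1}"
    using q_map_remainder[of "Suc j" x] q_map_bounds[OF x, of "Suc j"]
    by (simp add: lessThan_Suc_atMost del: funpow.simps)
next
  fix e :: "nat \<Rightarrow> int"
  assume e: "\<forall>j. e j \<in> {0..max_digit q} \<and>
     q ^ (j + 1) * (x - (\<Sum>k\<le>j. of_int (e k) / q ^ (k + 1))) \<in> {0..<1}"
  have "e j = \<lfloor>q * (q_map q ^^ j) x\<rfloor>" for j
  proof (induction j rule: less_induct)
    case (less j)
    let ?S = "x - (\<Sum>k<j. of_int \<lfloor>q * (q_map q ^^ k) x\<rfloor> / q ^ (k + 1))"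
    have "x - (\<Sum>k\<le>j. of_int (e k) / q ^ (k + 1)) = ?S - of_int (e j) / q ^ (j + 1)"
      using less by (simp flip: lessThan_Suc_atMost)
    then have "q ^ (j + 1) * (x - (\<Sum>k\<le>j. of_int (e k) / q ^ (k + 1))) =
        q ^ (j + 1) * (?S - of_int (e j) / q ^ (j + 1))"
      by (rule arg_cong)
    also have "\<dots> = q * (q ^ j * ?S) - of_int (e j)"
      using q_pos by (simp add: right_diff_distrib)
    also have "\<dots> = q * (q_map q ^^ j) x - of_int (e j)"
      unfolding q_map_remainder ..
    finally have "q * (q_map q ^^ j) x - of_int (e j) \<in> {0..<1}"
      using e by metis
    then show ?case
      by (intro floor_unique[symmetric]) auto
  qed
  then show "e = (\<lambda>j. \<lfloor>q * (q_map q ^^ j) x\<rfloor>)" by blast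
qed

section \<open>The left orbit of 1 and the digits of \<open>q - \<lfloor>q\<rfloor>\<close>\<close>

text \<open>The two maps differ only where \<open>q * t\<close> is an integer, and there the
  left-continuous one returns to 1; from 1 the next value is 1 or \<open>frac q\<close>.\<close>

lemma left_orbit_eq_q_map:
  "left_orbit q k = 1 \<or> (\<exists>m. left_orbit q k = (q_map q ^^ m) (frac q))"
proof (induction k)
  case 0
  then show ?case by (simp add: left_orbit_0)
next
  case (Suc k)
  have step: "left_orbit q (Suc k) = 1 \<or> left_orbit q (Suc k) = frac (q * left_orbit q k)"
  proof (cases "q * left_orbit q k \<in> \<int>")
    case True
    then show ?thesis by (auto simp: left_orbit_Suc elim: Ints_cases)
  next
    case False
    then have "\<lceil>q * left_orbit q k\<rceil> = \<lfloor>q * left_orbit q k\<rfloor> + 1"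
      by (simp add: ceiling_altdef) (metis Ints_of_int)
    then show ?thesis by (simp add: left_orbit_Suc frac_def)
  qed
  from Suc show ?case
  proof
    assume "left_orbit q k = 1"
    then show ?thesis using step by (metis funpow_0 mult.right_neutral)
  next
    assume "\<exists>m. left_orbit q k = (q_map q ^^ m) (frac q)"
    then obtain m where "left_orbit q k = (q_map q ^^ m) (frac q)" ..
    then have "frac (q * left_orbit q k) = (q_map q ^^ Suc m) (frac q)"
      by (simp only: q_map_funpow_Suc)
    then show ?thesis using step by metis
  qed
qed

text \<open>Otherwise some \<open>t\<close> in the left orbit has
  \<open>q ^ (K + 1) * t < 1\<close>. It belongs to the orbit of \<open>frac q\<close>, so
  multiplying by \<open>q\<close> without carry produces \<open>K + 1\<close> zero digits in a row,
  and since \<open>t > 0\<close> a nonzero digit follows them. This block counts for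
  \<open>K_zeros\<close>, a contradiction.\<close>

lemma left_orbit_ge:
  assumes "K_zeros q < \<infinity>"
  shows "1 \<le> q ^ (the_enat (K_zeros q) + 1) * left_orbit q k"
proof (rule ccontr)
  assume "\<not> ?thesis"
  then have small: "q ^ (the_enat (K_zeros q) + 1) * left_orbit q k < 1" by simp
  define K where "K = the_enat (K_zeros q)"
  have K: "K_zeros q = enat K"
    using assms by (auto simp: K_def)
  define t where "t = left_orbit q k"
  have t: "0 < t" "q ^ (K + 1) * t < 1"
    using left_orbit_bounds small by (auto simp: t_def K_def)
  have "1 < q ^ (K + 1)"
    using q_gt_1 by (intro one_less_power) auto
  then have "t \<noteq> 1" using t by auto
  then obtain m where m: "t = (q_map q ^^ m) (frac q)"
    using left_orbit_eq_q_map[of k] by (auto simp: t_def)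
  have digit: "real_q_expansion q (q - of_int \<lfloor>q\<rfloor>) j = \<lfloor>q * (q_map q ^^ j) (frac q)\<rfloor>" for j
    using real_q_expansion_eq[of "frac q"] by (simp add: frac_lt_1 flip: frac_def)
  have shift: "(q_map q ^^ (m + i)) (frac q) = q ^ i * t" if "q ^ i * t < 1" for i
    using that
  proof (induction i)
    case 0
    then show ?case by (simp add: m)
  next
    case (Suc i)
    have "q ^ i * t \<le> q ^ Suc i * t"
      using q_gt_1 t by simp
    then have "(q_map q ^^ (m + i)) (frac q) = q ^ i * t"
      using Suc by simp
    then have "(q_map q ^^ (m + Suc i)) (frac q) = frac (q ^ Suc i * t)"
      unfolding add_Suc_right q_map_funpow_Suc by (simp add: mult.assoc)
    also have "\<dots> = q ^ Suc i * t"
      using Suc.prems t q_pos by (subst frac_eq) auto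
    finally show ?case .
  qed
  have zero: "real_q_expansion q (q - of_int \<lfloor>q\<rfloor>) (m + i) = 0" if "q ^ Suc i * t < 1" for i
  proof -
    have "q ^ i * t \<le> q ^ Suc i * t"
      using q_gt_1 t by simp
    then have "q * (q_map q ^^ (m + i)) (frac q) = q ^ Suc i * t"
      using shift[of i] that by simp
    then show ?thesis
      unfolding digit using that t q_pos by (simp add: floor_eq_iff)
  qed
  have mono: "q ^ Suc i * t < 1" if "i \<le> K" for i
  proof -
    have "q ^ Suc i * t \<le> q ^ (K + 1) * t"
      using that t q_gt_1 by (intro mult_right_mono power_increasing) auto
    then show ?thesis using t by simp
  qed
  obtain i where i: "real_q_expansion q (q - of_int \<lfloor>q\<rfloor>) (m + i) \<noteq> 0"
  proof (rule ccontr)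
    assume "\<not> thesis"
    then have all_zero: "\<lfloor>q * (q_map q ^^ (m + i)) (frac q)\<rfloor> = 0" for i
      using that digit by metis
    have "q ^ i * t < 1" for i
    proof (induction i)
      case 0
      then show ?case using q_map_bounds[of "frac q" m] by (simp add: m frac_lt_1)
    next
      case (Suc i)
      then show ?case using all_zero[of i] shift[of i] by (simp add: floor_eq_iff mult.assoc)
    qed
    moreover obtain n where "1 / t < q ^ n"
      using real_arch_pow q_gt_1 by blast
    ultimately show False using t by (simp add: field_simps) (metis less_asym mult.commute)
  qed
  have "\<not> i \<le> K"
    using zero mono i by blast
  then have "enat (m + (K + 1)) \<le> enat (m + i + 1)"
    by simp
  also have "\<dots> \<le> last_nonzero_index q"
    unfolding last_nonzero_index_def by (rule Sup_upper) (use i in auto)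
  finally have "enat (m + (K + 1)) \<le> last_nonzero_index q" .
  moreover have "\<forall>j\<in>{m..<m + (K + 1)}. real_q_expansion q (q - of_int \<lfloor>q\<rfloor>) j = 0"
  proof
    fix j assume "j \<in> {m..<m + (K + 1)}"
    then show "real_q_expansion q (q - of_int \<lfloor>q\<rfloor>) j = 0"
      using zero[OF mono, of "j - m"] by auto
  qed
  ultimately have "enat (K + 1) \<le> K_zeros q"
    unfolding K_zeros_def by (intro Sup_upper) blast
  then show False using K by simp
qed

section \<open>The limit expansion at 1 and its minimal digit\<close>

text \<open>For small \<epsilon> the \<open>i\<close>-th iterate of \<open>1 - \<epsilon>\<close>
  stays \<open>q ^ i * \<epsilon>\<close> below the left orbit, and just below a point
  \<open>t\<close> the digit is \<open>\<lceil>q * t\<rceil> - 1\<close>.\<close>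

lemma left_limit_expansion_at_1_eq: "left_limit_expansion_at_1 q j = \<lceil>q * left_orbit q j\<rceil> - 1"
proof -
  have pos: "\<forall>\<^sub>F \<epsilon> in at_right 0. q ^ i * \<epsilon> < c" if "c > 0" for i c
  proof -
    have "((\<lambda>\<epsilon>. q ^ i * \<epsilon>) \<longlongrightarrow> q ^ i * 0) (at_right 0)"
      by (intro tendsto_intros)
    then show ?thesis
      using that by (intro order_tendstoD(2)[where y = "q ^ i * 0"]) auto
  qed
  have gap: "0 < left_orbit q (Suc i)" for i
    by (rule left_orbit_bounds)
  have eps: "\<forall>\<^sub>F \<epsilon> in at_right 0. 0 < (\<epsilon>::real)"
    by (simp add: eventually_at_right_less)
  have orbit: "\<forall>\<^sub>F \<epsilon> in at_right 0. (q_map q ^^ i) (1 - \<epsilon>) = left_orbit q i - q ^ i * \<epsilon>" for i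
  proof (induction i)
    case 0
    then show ?case by (simp add: left_orbit_0)
  next
    case (Suc i)
    from Suc pos[OF gap[of i], of "Suc i"] eps show ?case
    proof eventually_elim
      case (elim \<epsilon>)
      have "(q_map q ^^ Suc i) (1 - \<epsilon>) = frac (q * left_orbit q i - q ^ Suc i * \<epsilon>)"
        using elim unfolding q_map_funpow_Suc by (simp add: right_diff_distrib mult.assoc)
      also have "\<dots> = frac (left_orbit q (Suc i) - q ^ Suc i * \<epsilon> + of_int (\<lceil>q * left_orbit q i\<rceil> - 1))"
        by (simp add: left_orbit_Suc algebra_simps)
      also have "\<dots> = frac (left_orbit q (Suc i) - q ^ Suc i * \<epsilon>)"
        by (simp only: frac_add_of_int_right)
      also have "\<dots> = left_orbit q (Suc i) - q ^ Suc i * \<epsilon>"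
      proof -
        have "0 < q ^ Suc i * \<epsilon>" using elim q_pos by simp
        then show ?thesis
          using elim left_orbit_bounds(2)[of "Suc i"] by (subst frac_eq) auto
      qed
      finally show ?case .
    qed
  qed
  \<comment> \<open>The fact for exponent 0 says \<open>\<epsilon> < 1\<close>, so that
    \<open>real_q_expansion_eq\<close> applies.\<close>
  have "\<forall>\<^sub>F \<epsilon> in at_right 0. real_q_expansion q (1 - \<epsilon>) j = \<lceil>q * left_orbit q j\<rceil> - 1"
    using orbit[of j] pos[OF gap[of j], of "Suc j"] pos[of 1 0, OF zero_less_one] eps
  proof eventually_elim
    case (elim \<epsilon>)
    have "0 < q ^ Suc j * \<epsilon>" using elim q_pos by simp
    then have "\<lfloor>q * left_orbit q j - q ^ Suc j * \<epsilon>\<rfloor> = \<lceil>q * left_orbit q j\<rceil> - 1"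
      using elim(2) left_orbit_Suc[of j] left_orbit_bounds(2)[of "Suc j"]
      unfolding floor_eq_iff of_int_diff of_int_1 by linarith
    then show ?case
      using elim by (simp add: real_q_expansion_eq right_diff_distrib mult.assoc)
  qed
  then show ?thesis
    unfolding left_limit_expansion_at_1_def
    by (intro tendsto_Lim tendsto_eventually) auto
qed

text \<open>If every digit were at least \<open>\<lfloor>q\<rfloor>\<close>, the distance of the left orbit from \<open>1\<close> would grow
  geometrically.\<close>

lemma min_limit_digit_less: "min_limit_digit q < \<lfloor>q\<rfloor>"
proof (rule ccontr)
  assume "\<not> ?thesis"
  moreover have "min_limit_digit q \<le> \<lceil>q * left_orbit q j\<rceil> - 1" for j
  proof -
    \<comment> \<open>Finiteness is what makes \<open>Min\<close> a lower bound.\<close>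
    have "range (left_limit_expansion_at_1 q) \<subseteq> {0..\<lceil>q\<rceil>}"
    proof clarify
      fix j
      have "0 < q * left_orbit q j" "q * left_orbit q j \<le> q"
        using left_orbit_bounds[of j] q_pos by auto
      then show "left_limit_expansion_at_1 q j \<in> {0..\<lceil>q\<rceil>}"
        unfolding left_limit_expansion_at_1_eq by (auto simp: ceiling_le_iff) linarith+
    qed
    then have "finite (range (left_limit_expansion_at_1 q))"
      by (rule finite_subset) simp
    then show ?thesis
      unfolding min_limit_digit_def by (metis Min_le left_limit_expansion_at_1_eq rangeI)
  qed
  ultimately have digits_ge: "\<lfloor>q\<rfloor> \<le> \<lceil>q * left_orbit q j\<rceil> - 1" for j
    by (meson linorder_not_less order.trans)
  have step: "left_orbit q (Suc j) \<le> q * left_orbit q j - of_int \<lfloor>q\<rfloor>" for j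
    unfolding left_orbit_Suc
    by (intro diff_left_mono of_int_le_iff[THEN iffD2] digits_ge)
  \<comment> \<open>The first distance from 1: \<open>left_orbit q 1 \<le> 1 - c\<close>. Each later
    step multiplies the distance by at least \<open>q\<close>.\<close>
  define c where "c = of_int \<lfloor>q\<rfloor> + 1 - q"
  have "c > 0"
    unfolding c_def by linarith
  have "q ^ j * c \<le> 1 - left_orbit q (Suc j)" for j
  proof (induction j)
    case 0
    then show ?case using step[of 0] by (simp add: c_def left_orbit_0)
  next
    case (Suc j)
    have "q ^ Suc j * c \<le> q * (1 - left_orbit q (Suc j))"
      using Suc q_pos by (simp add: mult.assoc)
    also have "\<dots> \<le> 1 - left_orbit q (Suc (Suc j))"
      using step[of "Suc j"] \<open>c > 0\<close> by (simp add: c_def algebra_simps)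
    finally show ?case .
  qed
  then have "q ^ j * c < 1" for j
    using left_orbit_bounds(1)[of "Suc j"] by (smt (verit))
  moreover obtain n where "1 / c < q ^ n"
    using real_arch_pow q_gt_1 by blast
  ultimately show False
    using \<open>c > 0\<close> by (metis less_asym pos_divide_less_eq)
qed

end

section \<open>Approaching a point in Schmidt's game\<close>

text \<open>If Alice centers a ball at \<open>p\<close> and then always moves towards \<open>p\<close>, Bob can drive the outcome away
  from \<open>p\<close> by at most \<open>drift\<close> times the radius of the ball she answered.\<close>

definition drift :: "real \<Rightarrow> real \<Rightarrow> real" where
  "drift \<alpha> \<beta> = \<alpha> * max 0 (1 - 2 * \<beta> + \<alpha> * \<beta>) / (1 - \<alpha> * \<beta>)"

definition step_towards :: "'a::real_normed_vector \<Rightarrow> real \<Rightarrow> 'a \<Rightarrow> 'a" where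
  "step_towards p r x = (if dist x p \<le> r then p else x + (r / dist x p) *\<^sub>R (p - x))"

lemma dist_step_towards:
  assumes "0 \<le> r"
  shows "dist x (step_towards p r x) \<le> r"
    and "dist (step_towards p r x) p \<le> max 0 (dist x p - r)"
proof -
  show "dist x (step_towards p r x) \<le> r"
    using assms by (auto simp: step_towards_def dist_norm norm_minus_commute)
  have "dist (step_towards p r x) p = dist x p - r" if "\<not> dist x p \<le> r"
  proof -
    have pos: "dist x p > 0"
      using that assms by linarith
    have "step_towards p r x - p = (1 - r / dist x p) *\<^sub>R (x - p)"
      using that by (simp add: step_towards_def algebra_simps)
    then have "dist (step_towards p r x) p = \<bar>1 - r / dist x p\<bar> * dist x p"
      by (simp add: dist_norm)
    also have "\<dots> = dist x p - r"
      using that pos by (simp add: field_simps abs_if)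
    finally show ?thesis .
  qed
  then show "dist (step_towards p r x) p \<le> max 0 (dist x p - r)"
    by (cases "dist x p \<le> r") (simp_all add: step_towards_def)
qed

lemma step_towards_in_convex:
  assumes "convex X" "x \<in> X" "p \<in> X" "0 \<le> r"
  shows "step_towards p r x \<in> X"
proof (cases "dist x p \<le> r")
  case True
  then show ?thesis using assms by (simp add: step_towards_def)
next
  case False
  let ?s = "r / dist x p"
  have "0 \<le> ?s" "?s \<le> 1"
    using False assms by (auto simp: divide_simps)
  then have "(1 - ?s) *\<^sub>R x + ?s *\<^sub>R p \<in> X"
    using assms by (intro convexD_alt) auto
  moreover have "(1 - ?s) *\<^sub>R x + ?s *\<^sub>R p = step_towards p r x"
    using False by (simp add: step_towards_def algebra_simps)
  ultimately show ?thesis by simp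
qed

text \<open>Alice repeats Bob's centers before \<open>x n\<close>, answers \<open>x n\<close> with a
  point \<open>p\<close> chosen from it, and then keeps stepping towards \<open>p\<close>. Although
  \<open>X\<close> may be incomplete, the outcome exists: the centers converge in the whole space,
  and the limit lies in the ball around \<open>p\<close>, hence in \<open>S\<close> and in
  \<open>X\<close>.\<close>

lemma winning_by_approach:
  fixes X S :: "'a::banach set"
  assumes \<alpha>: "0 < \<alpha>" "\<alpha> < 1" and \<beta>: "0 < \<beta>" "\<beta> < 1" and "convex X" and "S \<subseteq> X"
    and approach: "\<And>\<rho>. \<rho> > 0 \<Longrightarrow> \<exists>n. \<forall>x\<in>X. \<exists>p\<in>X. dist x p \<le> (1 - \<alpha>) * game_radius \<alpha> \<beta> \<rho> n \<and>
        cball p (drift \<alpha> \<beta> * game_radius \<alpha> \<beta> \<rho> n) \<subseteq> S"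
  shows "winning X \<alpha> \<beta> S"
  unfolding winning_def
proof (intro allI impI)
  fix \<rho> :: real assume "\<rho> > 0"
  define R where "R = game_radius \<alpha> \<beta> \<rho>"
  have R_pos: "R m > 0" for m
    using \<alpha> \<beta> \<open>\<rho> > 0\<close> by (simp add: R_def game_radius_def)
  have R_Suc: "R (Suc m) = \<alpha> * \<beta> * R m" for m
    by (simp add: R_def game_radius_def)
  have \<alpha>\<beta>: "0 < \<alpha> * \<beta>" "\<alpha> * \<beta> < 1"
    using \<alpha> \<beta> mult_strict_mono[of \<alpha> 1 \<beta> 1] by auto
  have R_lim: "R \<longlonglongrightarrow> 0"
    unfolding R_def game_radius_def using \<alpha>\<beta> by (auto intro!: tendsto_mult_left_zero LIMSEQ_power_zero)
  have move_nonneg: "0 \<le> (1 - \<alpha>) * R m" for m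
    using R_pos[of m] \<alpha> by simp
  obtain n where "\<forall>x\<in>X. \<exists>p\<in>X. dist x p \<le> (1 - \<alpha>) * R n \<and> cball p (drift \<alpha> \<beta> * R n) \<subseteq> S"
    using approach[OF \<open>\<rho> > 0\<close>] by (auto simp: R_def)
  then obtain P where P: "\<And>x. x \<in> X \<Longrightarrow> P x \<in> X" "\<And>x. x \<in> X \<Longrightarrow> dist x (P x) \<le> (1 - \<alpha>) * R n"
    "\<And>x. x \<in> X \<Longrightarrow> cball (P x) (drift \<alpha> \<beta> * R n) \<subseteq> S"
    by metis
  \<comment> \<open>The list at her move \<open>Suc m\<close> has length \<open>Suc m\<close> and
    ends in \<open>x m\<close>; entry \<open>n\<close> lets her recover the same \<open>p\<close> in
    every later round.\<close>
  define \<sigma> where "\<sigma> xs = (if length xs \<le> n then last xs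
    else step_towards (P (xs ! n)) ((1 - \<alpha>) * R (length xs - 1)) (last xs))" for xs
  have move: "alice_move \<sigma> x (Suc m) =
      (if m < n then x m else step_towards (P (x n)) ((1 - \<alpha>) * R m) (x m))" for x m
  proof (cases "m < n")
    case False
    then have "map x [0..<Suc m] ! n = x n"
      by (subst nth_map) (auto simp del: upt_Suc)
    then show ?thesis
      using False by (simp add: alice_move_def \<sigma>_def last_map del: list.map)
  qed (simp add: alice_move_def \<sigma>_def)
  have legal: "alice_legal X \<alpha> \<beta> \<rho> \<sigma> x m" if "m \<ge> 1" "\<forall>k<m. bob_legal X \<alpha> \<beta> \<rho> \<sigma> x k" for x m
  proof -
    obtain k where m: "m = Suc k"
      using \<open>m \<ge> 1\<close> by (cases m) auto
    have "x i \<in> X" if "i \<le> k" for i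
      using \<open>\<forall>k<m. _ k\<close> that m by (auto simp: bob_legal_def)
    then have "alice_move \<sigma> x m \<in> X \<and> dist (x k) (alice_move \<sigma> x m) \<le> (1 - \<alpha>) * R k"
      unfolding m move using P(1) \<open>convex X\<close> move_nonneg
      by (auto intro!: step_towards_in_convex dist_step_towards(1))
    then show ?thesis
      unfolding alice_legal_def m by (simp add: R_def algebra_simps)
  qed
  have wins: "alice_wins X \<alpha> \<beta> \<rho> S x" if bob: "\<forall>m. bob_legal X \<alpha> \<beta> \<rho> \<sigma> x m" for x
  proof -
    define y where "y m = alice_move \<sigma> x (Suc m)" for m
    have xX: "x m \<in> X" for m
      using bob by (auto simp: bob_legal_def)
    have xy: "dist (x m) (y m) \<le> (1 - \<alpha>) * R m" for m
      using legal[of "Suc m" x] bob by (simp add: alice_legal_def y_def R_def algebra_simps)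
    have yx: "dist (y m) (x (Suc m)) \<le> \<alpha> * R m - R (Suc m)" for m
      using bob[rule_format, of "Suc m"] by (simp add: bob_legal_def y_def R_def)
    have nested: "dist (x m) (x (m + k)) \<le> R m - R (m + k)" for m k
    proof (induction k)
      case (Suc k)
      have "dist (x m) (x (m + Suc k)) \<le> dist (x m) (x (m + k)) + dist (x (m + k)) (x (Suc (m + k)))"
        by (simp add: dist_triangle)
      also have "dist (x (m + k)) (x (Suc (m + k))) \<le> R (m + k) - R (Suc (m + k))"
        using dist_triangle[of "x (m + k)" "x (Suc (m + k))" "y (m + k)"] xy[of "m + k"] yx[of "m + k"]
        by (simp add: algebra_simps)
      finally show ?case using Suc by simp
    qed simp
    have near: "dist (x m) (x k) \<le> R m" if "m \<le> k" for m k
      using nested[of m "k - m"] R_pos[of k] that by simp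
    have "Cauchy x"
      unfolding Cauchy_altdef2
    proof (intro allI impI)
      fix e :: real assume "e > 0"
      then have "\<forall>\<^sub>F m in sequentially. R m < e"
        using R_lim by (intro order_tendstoD(2)[where y = 0]) auto
      then obtain N where "R N < e"
        by (auto simp: eventually_sequentially)
      then show "\<exists>N. \<forall>m\<ge>N. dist (x m) (x N) < e"
        using near by (metis dist_commute order_le_less_trans)
    qed
    then have "convergent x"
      by (rule Cauchy_convergent)
    then obtain \<omega> where \<omega>: "x \<longlonglongrightarrow> \<omega>"
      unfolding convergent_def by blast
    have \<omega>_ball: "dist (x m) \<omega> \<le> R m" for m
    proof (rule LIMSEQ_le_const2)
      show "(\<lambda>k. dist (x m) (x k)) \<longlonglongrightarrow> dist (x m) \<omega>"
        using \<omega> by (intro tendsto_intros)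
      show "\<exists>N. \<forall>k\<ge>N. dist (x m) (x k) \<le> R m"
        using near by blast
    qed
    define p where "p = P (x n)"
    have y_n: "y n = p"
      using P(2)[OF xX, of n] by (simp add: y_def move p_def step_towards_def)
    have drift_nonneg: "0 \<le> drift \<alpha> \<beta>"
      using \<alpha> \<alpha>\<beta> by (simp add: drift_def)
    have approx: "dist (y (n + k)) p \<le> drift \<alpha> \<beta> * (R n - R (n + k))" for k
    proof (induction k)
      case 0
      then show ?case by (simp add: y_n)
    next
      case (Suc k)
      let ?m = "n + k"
      \<comment> \<open>Bob's largest legal move minus Alice's way back, bounded by a share of the
        radius lost in this round, so that the sum over the rounds telescopes.\<close>
      have bound: "\<alpha> * R ?m - R (Suc ?m) - (1 - \<alpha>) * R (Suc ?m) \<le> drift \<alpha> \<beta> * (R ?m - R (Suc ?m))"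
      proof -
        have "\<alpha> * R ?m - R (Suc ?m) - (1 - \<alpha>) * R (Suc ?m) = \<alpha> * (1 - 2 * \<beta> + \<alpha> * \<beta>) * R ?m"
          by (simp add: R_Suc algebra_simps)
        also have "\<dots> \<le> \<alpha> * max 0 (1 - 2 * \<beta> + \<alpha> * \<beta>) * R ?m"
          using \<alpha> R_pos[of ?m] by (intro mult_right_mono mult_left_mono) auto
        also have "\<dots> = drift \<alpha> \<beta> * ((1 - \<alpha> * \<beta>) * R ?m)"
          using \<alpha>\<beta> by (simp add: drift_def)
        also have "(1 - \<alpha> * \<beta>) * R ?m = R ?m - R (Suc ?m)"
          by (simp add: R_Suc algebra_simps)
        finally show ?thesis .
      qed
      have "y (Suc ?m) = step_towards p ((1 - \<alpha>) * R (Suc ?m)) (x (Suc ?m))"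
        by (simp add: y_def move p_def)
      then have "dist (y (Suc ?m)) p \<le> max 0 (dist (x (Suc ?m)) p - (1 - \<alpha>) * R (Suc ?m))"
        using dist_step_towards(2)[OF move_nonneg] by simp
      also have "\<dots> \<le> drift \<alpha> \<beta> * (R n - R (Suc ?m))"
      proof (rule max.boundedI)
        have "R (Suc ?m) \<le> R n"
          using nested[of n "Suc k"] order_trans[OF zero_le_dist] by fastforce
        then show "0 \<le> drift \<alpha> \<beta> * (R n - R (Suc ?m))"
          using drift_nonneg by simp
        have "dist (x (Suc ?m)) p \<le> dist (y ?m) (x (Suc ?m)) + dist (y ?m) p"
          by (rule dist_triangle3)
        then show "dist (x (Suc ?m)) p - (1 - \<alpha>) * R (Suc ?m) \<le> drift \<alpha> \<beta> * (R n - R (Suc ?m))"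
          using yx[of ?m] Suc bound by (simp add: right_diff_distrib)
      qed
      finally show ?case by simp
    qed
    have "dist \<omega> p \<le> drift \<alpha> \<beta> * R n"
    proof (rule LIMSEQ_le)
      show "(\<lambda>k. dist (x (k + n)) p) \<longlonglongrightarrow> dist \<omega> p"
        using \<omega> by (intro tendsto_intros LIMSEQ_ignore_initial_segment)
      have "(\<lambda>k. drift \<alpha> \<beta> * (R n - R (k + n)) + (1 - \<alpha>) * R (k + n)) \<longlonglongrightarrow>
          drift \<alpha> \<beta> * (R n - 0) + (1 - \<alpha>) * 0"
        by (intro tendsto_intros LIMSEQ_ignore_initial_segment R_lim)
      then show "(\<lambda>k. drift \<alpha> \<beta> * (R n - R (k + n)) + (1 - \<alpha>) * R (k + n)) \<longlonglongrightarrow> drift \<alpha> \<beta> * R n"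
        by simp
      show "\<exists>N. \<forall>k\<ge>N. dist (x (k + n)) p \<le> drift \<alpha> \<beta> * (R n - R (k + n)) + (1 - \<alpha>) * R (k + n)"
      proof (intro exI[of _ 0] allI impI)
        fix k :: nat
        show "dist (x (k + n)) p \<le> drift \<alpha> \<beta> * (R n - R (k + n)) + (1 - \<alpha>) * R (k + n)"
          using dist_triangle[of "x (k + n)" p "y (k + n)"] xy[of "k + n"] approx[of k]
          by (simp add: add.commute)
      qed
    qed
    then have "\<omega> \<in> S"
      using P(3)[OF xX, of n] by (auto simp: p_def dist_commute)
    have "(\<Inter>m. cball (x m) (R m) \<inter> X) = {\<omega>}"
    proof
      show "{\<omega>} \<subseteq> (\<Inter>m. cball (x m) (R m) \<inter> X)"
        using \<omega>_ball \<open>\<omega> \<in> S\<close> \<open>S \<subseteq> X\<close> by auto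
      show "(\<Inter>m. cball (x m) (R m) \<inter> X) \<subseteq> {\<omega>}"
      proof
        fix z assume "z \<in> (\<Inter>m. cball (x m) (R m) \<inter> X)"
        then have "dist (x m) z \<le> R m" for m by auto
        then have "(\<lambda>m. dist (x m) z) \<longlonglongrightarrow> 0"
          by (intro tendsto_sandwich[OF _ _ tendsto_const R_lim]) auto
        then have "x \<longlonglongrightarrow> z"
          by (subst tendsto_dist_iff)
        then show "z \<in> {\<omega>}"
          using \<omega> LIMSEQ_unique by blast
      qed
    qed
    then show ?thesis
      using \<open>\<omega> \<in> S\<close> by (auto simp: alice_wins_def R_def)
  qed
  show "\<exists>\<sigma>. \<forall>x. (\<forall>n\<ge>1. (\<forall>m<n. bob_legal X \<alpha> \<beta> \<rho> \<sigma> x m) \<longrightarrow> alice_legal X \<alpha> \<beta> \<rho> \<sigma> x n) \<and>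
      ((\<forall>m. bob_legal X \<alpha> \<beta> \<rho> \<sigma> x m) \<longrightarrow> alice_wins X \<alpha> \<beta> \<rho> S x)"
    using legal wins by blast
qed

section \<open>Matching the radii of the game with powers of \<open>q\<close>\<close>

text \<open>In logarithms, \<open>n * \<theta> - j\<close> has to fall into an open interval with
  midpoint \<open>t\<close> and half-length \<epsilon>. As \<theta> is irrational, its multiples are
  dense modulo 1.\<close>

lemma ex_power_ratio_between:
  fixes q g \<rho> lo hi :: real
  assumes "1 < q" "0 < g" "g < 1" "log q g \<notin> \<rat>" "0 < \<rho>" "lo < hi" "0 < hi"
  obtains n j where "N \<le> j" "lo * (g ^ n * \<rho>) < 1 / q ^ j" "1 / q ^ j < hi * (g ^ n * \<rho>)"
proof -
  \<comment> \<open>\<open>lo\<close> may be 0 or negative; a positive bound above it has a usable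
    logarithm.\<close>
  define lo' where "lo' = (max 0 lo + hi) / 2"
  have lo': "lo < lo'" "0 < lo'" "lo' < hi"
    using assms by (auto simp: lo'_def)
  define \<theta> where "\<theta> = - log q g"
  have "\<theta> > 0"
    using assms by (simp add: \<theta>_def log_less_zero_cancel_iff)
  define \<epsilon> where "\<epsilon> = (log q hi - log q lo') / 2"
  have "\<epsilon> > 0"
    using lo' assms by (simp add: \<epsilon>_def)
  define t where "t = (log q hi + log q lo') / 2 + log q \<rho>"
  \<comment> \<open>Density is used for the multiples of \<open>M * \<theta>\<close>, with
    \<open>M\<close> so large that every positive multiple forces the integer \<open>h\<close> above
    \<open>N\<close>.\<close>
  obtain M :: nat where "max 0 ((real N + t + \<epsilon>) / \<theta>) < M"
    using reals_Archimedean2 by blast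
  then have M: "(real N + t + \<epsilon>) / \<theta> < M" "M > 0"
    by auto
  have "of_nat M * \<theta> \<notin> \<rat>"
  proof
    assume "of_nat M * \<theta> \<in> \<rat>"
    then have "of_nat M * \<theta> / of_nat M \<in> \<rat>"
      by (intro Rats_divide) auto
    then have "- \<theta> \<in> \<rat>"
      using \<open>M > 0\<close> by simp
    then show False
      using assms by (simp add: \<theta>_def)
  qed
  then obtain h k where k: "k > 0" and hk: "\<bar>of_int k * (of_nat M * \<theta>) - of_int h - t\<bar> < \<epsilon>"
    using sequence_of_fractional_parts_is_dense[OF _ \<open>\<epsilon> > 0\<close>] by metis
  define n where "n = nat k * M"
  have n: "real n * \<theta> = of_int k * (of_nat M * \<theta>)"
    using k by (simp add: n_def)
  have "1 * (M * \<theta>) \<le> of_int k * (of_nat M * \<theta>)"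
    using k \<open>\<theta> > 0\<close> by (intro mult_right_mono) auto
  moreover have "real N + t + \<epsilon> < M * \<theta>"
    using M \<open>\<theta> > 0\<close> by (simp add: field_simps)
  ultimately have "real N < of_int h"
    using hk by linarith
  then have "int N < h"
    by (metis of_int_less_iff of_int_of_nat_eq)
  define j where "j = nat h"
  have j: "real j = of_int h" "N \<le> j"
    using \<open>int N < h\<close> by (auto simp: j_def)
  have log_j: "log q (1 / q ^ j) = - real j"
    using assms by (simp add: log_divide log_nat_power)
  have log_R: "log q (c * (g ^ n * \<rho>)) = log q c - real n * \<theta> + log q \<rho>" if "c > 0" for c
    using assms that by (simp add: log_mult log_nat_power \<theta>_def)
  have "\<bar>real n * \<theta> - real j - t\<bar> < \<epsilon>"
    unfolding n j using hk .
  then have "log q (lo' * (g ^ n * \<rho>)) < log q (1 / q ^ j)"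
    "log q (1 / q ^ j) < log q (hi * (g ^ n * \<rho>))"
    unfolding log_j log_R[OF lo'(2)] log_R[OF assms(7)] \<epsilon>_def t_def
    by (simp_all add: abs_less_iff field_simps)
  then have "lo' * (g ^ n * \<rho>) < 1 / q ^ j" "1 / q ^ j < hi * (g ^ n * \<rho>)"
    using assms lo' by (auto simp: log_less_cancel_iff)
  moreover have "lo * (g ^ n * \<rho>) \<le> lo' * (g ^ n * \<rho>)"
    using assms lo' by (intro mult_right_mono) auto
  ultimately show thesis
    by (intro that[OF j(2), of n]) linarith+
qed

section \<open>Expansions of quaternions with a real base\<close>

lemma lipschitz_quat_iff: "z \<in> lipschitz_quat \<longleftrightarrow> (\<forall>i. z $ i \<in> \<int>)"
proof
  assume "\<forall>i. z $ i \<in> \<int>"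
  then have "z = Quat (of_int \<lfloor>z $ 1\<rfloor>) (of_int \<lfloor>z $ 2\<rfloor>) (of_int \<lfloor>z $ 3\<rfloor>) (of_int \<lfloor>z $ 4\<rfloor>)"
    by (simp add: vec_eq_iff forall_4)
  then show "z \<in> lipschitz_quat"
    unfolding lipschitz_quat_def by blast
qed (auto simp: lipschitz_quat_def forall_4)

lemma unit_cube_iff: "z \<in> unit_cube \<longleftrightarrow> (\<forall>i. z $ i \<in> {0..<1})"
proof
  assume "\<forall>i. z $ i \<in> {0..<1}"
  moreover have "z = Quat (z $ 1) (z $ 2) (z $ 3) (z $ 4)"
    by (simp add: vec_eq_iff forall_4)
  ultimately show "z \<in> unit_cube"
    unfolding unit_cube_def by blast
qed (auto simp: unit_cube_def forall_4)

lemma convex_unit_cube: "convex unit_cube"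
  unfolding convex_alt
proof (intro ballI allI impI)
  fix x y :: quat and s :: real
  assume xy: "x \<in> unit_cube" "y \<in> unit_cube" and s: "0 \<le> s \<and> s \<le> 1"
  have "(1 - s) * x $ i + s * y $ i \<in> {0..<1}" for i
    using convexD_alt[of "{0..<1::real}" "x $ i" "y $ i" s] xy s by (simp add: unit_cube_iff)
  then show "(1 - s) *\<^sub>R x + s *\<^sub>R y \<in> unit_cube"
    by (simp add: unit_cube_iff)
qed

text \<open>For a real base the Hamilton product is a scaling, and lattice and cube are products, so
  the digit is found in each coordinate separately.\<close>

lemma lead_digit_real_base:
  "lead_digit lipschitz_quat unit_cube (quat_of_real q) z = (\<chi> i. of_int \<lfloor>q * z $ i\<rfloor>)"
  unfolding lead_digit_def
proof (rule the_equality, goal_cases)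
  case 1
  have "q * z $ i - of_int \<lfloor>q * z $ i\<rfloor> \<in> {0..<1}" for i
    by (simp add: frac_lt_1 flip: frac_def)
  then show ?case
    by (simp add: lipschitz_quat_iff unit_cube_iff qmult_of_real)
next
  case (2 d)
  have "d $ i = of_int \<lfloor>q * z $ i\<rfloor>" for i
  proof -
    have "d $ i \<in> \<int>" and frac: "q * z $ i - d $ i \<in> {0..<1}"
      using 2 by (simp_all add: lipschitz_quat_iff unit_cube_iff qmult_of_real)
    then obtain m where m: "d $ i = of_int m"
      by (auto elim: Ints_cases)
    then have "\<lfloor>q * z $ i\<rfloor> = m"
      using frac by (intro floor_unique) auto
    then show ?thesis using m by simp
  qed
  then show ?case by (simp add: vec_eq_iff)
qed

lemma shift_map_real_base:
  "(shift_map lipschitz_quat unit_cube (quat_of_real q) ^^ j) z $ i = (q_map q ^^ j) (z $ i)"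
  by (induction j) (simp_all add: shift_map_def lead_digit_real_base qmult_of_real q_map_def frac_def)

text \<open>The factor 2 is the square root of the dimension 4.\<close>

lemma norm_le_2_componentwise:
  fixes v :: quat
  assumes "\<And>i. \<bar>v $ i\<bar> \<le> c"
  shows "norm v \<le> 2 * c"
proof -
  have "0 \<le> c"
    using assms[of 1] by linarith
  have "(\<Sum>i\<in>UNIV. (v $ i)\<^sup>2) \<le> (\<Sum>i\<in>(UNIV :: 4 set). c\<^sup>2)"
    using assms by (intro sum_mono abs_le_square_iff[THEN iffD1]) (simp add: order_trans[OF _ abs_ge_self])
  then have "norm v \<le> sqrt ((2 * c)\<^sup>2)"
    by (simp add: norm_vec_def L2_set_def power_mult_distrib)
  then show ?thesis
    using \<open>0 \<le> c\<close> by (subst (asm) real_sqrt_abs) simp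
qed

section \<open>Balls inside the target set\<close>

context q_expansion
begin

text \<open>On a full cylinder the next digit is the floor of
  \<open>q ^ Suc j * (z $ i - u i)\<close>. One order \<open>j\<close> serves all coordinates, since
  the four digits must occur at the same position.\<close>

lemma digit_appears_if_full_cylinders:
  fixes a :: "4 \<Rightarrow> int"
  assumes full: "\<And>i. full_cylinder q j (u i)" and a: "\<And>i. 0 \<le> a i" "\<And>i. of_int (a i) + 1 \<le> q"
    and z: "\<And>i. u i + of_int (a i) / q ^ Suc j \<le> z $ i" "\<And>i. z $ i < u i + (of_int (a i) + 1) / q ^ Suc j"
  shows "z \<in> digit_appears lipschitz_quat unit_cube (quat_of_real q) (\<chi> i. of_int (a i))"
proof -
  have Q: "q ^ j > 0" "q ^ Suc j > 0"
    using q_pos by auto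
  have coord: "z $ i \<in> {0..<1} \<and> \<lfloor>q * (q_map q ^^ j) (z $ i)\<rfloor> = a i" for i
  proof -
    define x where "x = z $ i - u i"
    have "(of_int (a i) + 1) / q ^ Suc j \<le> q / q ^ Suc j"
      using a Q by (intro divide_right_mono) auto
    also have "\<dots> = 1 / q ^ j"
      using q_pos by simp
    finally have "x < 1 / q ^ j"
      using z(2)[of i] by (simp add: x_def)
    moreover have "of_int (a i) / q ^ Suc j \<le> x"
      using z(1)[of i] by (simp add: x_def)
    moreover have "0 \<le> of_int (a i) / q ^ Suc j"
      using a Q by simp
    ultimately have x: "0 \<le> x" "x < 1 / q ^ j" and lower: "of_int (a i) / q ^ Suc j \<le> x"
      by linarith+
    have upper: "x < (of_int (a i) + 1) / q ^ Suc j"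
      using z(2)[of i] by (simp add: x_def)
    have "(q_map q ^^ j) (u i + x) = q ^ j * x"
      using full[of i] x unfolding cylinder_def by blast
    then have "q * (q_map q ^^ j) (z $ i) = x * q ^ Suc j"
      by (simp add: x_def)
    moreover have "of_int (a i) \<le> x * q ^ Suc j" "x * q ^ Suc j < of_int (a i) + 1"
      using lower upper pos_divide_le_eq[OF Q(2)] pos_less_divide_eq[OF Q(2)] by blast+
    ultimately have "\<lfloor>q * (q_map q ^^ j) (z $ i)\<rfloor> = a i"
      by (simp only: floor_eq_iff)
    moreover have "z $ i \<in> {0..<1}"
      using full[of i] x by (auto simp: cylinder_def x_def)
    ultimately show ?thesis by simp
  qed
  then have "z \<in> unit_cube"
    by (simp add: unit_cube_iff)
  moreover have "expansion_digit lipschitz_quat unit_cube (quat_of_real q) z (Suc j) = (\<chi> i. of_int (a i))"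
    using coord by (simp add: expansion_digit_def lead_digit_real_base shift_map_real_base vec_eq_iff)
  ultimately show ?thesis
    unfolding digit_appears_def by (auto intro!: exI[of _ "Suc j"])
qed

text \<open>\<open>full_cylinder_before\<close> looks only to the left, so it is applied at
  \<open>s + r - c\<close>; then \<open>x\<close> and \<open>u + c\<close> both lie between
  \<open>s\<close> and \<open>s + r\<close>.\<close>

lemma full_cylinder_near:
  assumes K: "\<And>k. 1 \<le> q ^ (K + 1) * left_orbit q k"
    and x: "0 \<le> x" "x < 1" and c: "0 < c" "c \<le> 1 / q ^ j" and L: "(real K + 2) / q ^ j \<le> 1 / 2"
  shows "\<exists>u. full_cylinder q j u \<and> \<bar>x - (u + c)\<bar> \<le> (real K + 2) / q ^ j"
proof -
  define r where "r = (real K + 2) / q ^ j"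
  have "1 / q ^ j \<le> r"
    unfolding r_def using q_pos by (intro divide_right_mono) auto
  then have r: "c \<le> r" "r \<le> 1 / 2"
    using c L by (auto simp: r_def)
  \<comment> \<open>Near 1 the interval is put to the left of \<open>x\<close>;
    \<open>r \<le> 1 / 2\<close> keeps it inside [0,1).\<close>
  define s where "s = (if x + r < 1 then x else x - r)"
  have s: "0 \<le> s" "s + r < 1" "s \<le> x" "x \<le> s + r"
    using x r c by (auto simp: s_def)
  then obtain u where "full_cylinder q j u" "u \<le> s + r - c" "s + r - c \<le> u + r"
    using full_cylinder_before[OF K, of "s + r - c" j] c r unfolding r_def by auto
  then show ?thesis
    using s unfolding r_def[symmetric] by (intro exI[of _ u]) auto
qed

text \<open>\<open>p\<close> is the center of a cube whose sides are digit intervals of length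
  \<open>1 / q ^ Suc j\<close>; the ball fits because \<delta> is less than half of this
  length.\<close>

lemma ball_in_digit_appears:
  fixes a :: "4 \<Rightarrow> int"
  assumes K: "\<And>k. 1 \<le> q ^ (K + 1) * left_orbit q k"
    and a: "\<And>i. 0 \<le> a i" "\<And>i. of_int (a i) + 1 \<le> q"
    and x: "x \<in> unit_cube" and L: "(real K + 2) / q ^ j \<le> 1 / 2"
    and \<delta>: "0 \<le> \<delta>" "2 * q * \<delta> < 1 / q ^ j"
  shows "\<exists>p\<in>unit_cube. dist x p \<le> 2 * ((real K + 2) / q ^ j) \<and>
    cball p \<delta> \<subseteq> digit_appears lipschitz_quat unit_cube (quat_of_real q) (\<chi> i. of_int (a i))"
proof -
  have Q: "q ^ Suc j > 0"
    using q_pos by simp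
  define c where "c i = (of_int (a i) + 1 / 2) / q ^ Suc j" for i
  have "0 < c i" "c i \<le> 1 / q ^ j" for i
  proof -
    show "0 < c i"
      using a(1)[of i] Q by (simp add: c_def)
    have "c i \<le> q / q ^ Suc j"
      unfolding c_def using a(2)[of i] Q by (intro divide_right_mono) auto
    then show "c i \<le> 1 / q ^ j"
      using q_pos by simp
  qed
  then have "\<exists>u. full_cylinder q j u \<and> \<bar>x $ i - (u + c i)\<bar> \<le> (real K + 2) / q ^ j" for i
    using x by (intro full_cylinder_near[OF K _ _ _ _ L]) (auto simp: unit_cube_iff)
  then obtain u where u: "\<And>i. full_cylinder q j (u i)"
    "\<And>i. \<bar>x $ i - (u i + c i)\<bar> \<le> (real K + 2) / q ^ j"
    by metis
  define p :: quat where "p = (\<chi> i. u i + c i)"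
  have "dist x p \<le> 2 * ((real K + 2) / q ^ j)"
    unfolding dist_norm using u(2) by (intro norm_le_2_componentwise) (simp add: p_def)
  moreover have in_S: "z \<in> digit_appears lipschitz_quat unit_cube (quat_of_real q) (\<chi> i. of_int (a i))"
    if "z \<in> cball p \<delta>" for z
  proof (rule digit_appears_if_full_cylinders[OF u(1) a])
    fix i
    have "\<bar>z $ i - p $ i\<bar> \<le> \<delta>"
      using that component_le_norm_cart[of "z - p" i] by (simp add: dist_norm norm_minus_commute)
    moreover have "\<delta> < (1 / 2) / q ^ Suc j"
      using \<delta> q_pos by (simp add: field_simps)
    ultimately have near: "\<bar>z $ i - (u i + c i)\<bar> < (1 / 2) / q ^ Suc j"
      by (simp add: p_def)
    have c: "c i = of_int (a i) / q ^ Suc j + (1 / 2) / q ^ Suc j"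
      "(of_int (a i) + 1) / q ^ Suc j = c i + (1 / 2) / q ^ Suc j"
      by (simp_all only: c_def flip: add_divide_distrib) simp
    show "u i + of_int (a i) / q ^ Suc j \<le> z $ i"
      using near c(1) by linarith
    show "z $ i < u i + (of_int (a i) + 1) / q ^ Suc j"
      unfolding c(2) using near by linarith
  qed
  \<comment> \<open>\<open>p\<close> lies in its own ball, hence in the target, which is part of the
    cube.\<close>
  moreover have "p \<in> unit_cube"
    using in_S[of p] \<delta> by (simp add: digit_appears_def)
  ultimately show ?thesis
    by (intro bexI[of _ p]) auto
qed

end

section \<open>The parameters of the game and the conclusion\<close>

text \<open>In \<open>A_2q\<close> the term \<open>K * b + 2 * b\<close> is
  \<open>c = 2 * q * (K + 2)\<close>. Clearing the positive denominator gives \<open>2 * c *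
  (\<alpha> * (1 - 2 * \<beta> + \<alpha> * \<beta>)) < (1 - \<alpha>) * (1 - \<alpha> *
  \<beta>)\<close>, a bound on \<open>drift\<close>. It leaves an open range for the ratio of
  \<open>1 / q ^ j\<close> to the radius.\<close>

lemma drift_less_if_A_2q_less:
  assumes "q > 1" "0 < \<alpha>" "\<alpha> < 1" "0 < \<beta>" "\<beta> < 1" "A_2q q \<alpha> < \<beta>"
  shows "2 * q * drift \<alpha> \<beta> < (1 - \<alpha>) / (2 * (real (the_enat (K_zeros q)) + 2))"
proof -
  define K where "K = real (the_enat (K_zeros q))"
  define c where "c = 2 * q * (K + 2)"
  have "K \<ge> 0"
    by (simp add: K_def)
  have "(2 * 1) * 2 \<le> c"
    unfolding c_def using assms \<open>K \<ge> 0\<close> by (intro mult_mono) auto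
  then have "4 \<le> c" by simp
  have "\<alpha> * \<beta> < 1"
    using assms mult_strict_mono[of \<alpha> 1 \<beta> 1] by simp
  have "\<alpha> * (2 * c - 1) \<le> 2 * c - 1"
    using assms \<open>4 \<le> c\<close> by (intro mult_left_le_one_le) auto
  then have "0 < (4 * c - 1) - \<alpha> * (2 * c - 1)"
    using \<open>4 \<le> c\<close> by linarith
  then have D: "0 < \<alpha> * ((4 * c - 1) - \<alpha> * (2 * c - 1))"
    using assms by (intro mult_pos_pos) auto
  have "A_2q q \<alpha> = ((2 * c + 1) * \<alpha> - 1) / (\<alpha> * ((4 * c - 1) - \<alpha> * (2 * c - 1)))"
    unfolding A_2q_def Let_def c_def K_def by (simp add: algebra_simps)
  then have "(2 * c + 1) * \<alpha> - 1 < \<beta> * (\<alpha> * ((4 * c - 1) - \<alpha> * (2 * c - 1)))"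
    using assms(6) D by (simp add: pos_divide_less_eq)
  then have "2 * c * (\<alpha> * (1 - 2 * \<beta> + \<alpha> * \<beta>)) < (1 - \<alpha>) * (1 - \<alpha> * \<beta>)"
    by (simp add: algebra_simps)
  moreover have "0 < (1 - \<alpha>) * (1 - \<alpha> * \<beta>)"
    using assms \<open>\<alpha> * \<beta> < 1\<close> by simp
  ultimately have "2 * c * (\<alpha> * max 0 (1 - 2 * \<beta> + \<alpha> * \<beta>)) < (1 - \<alpha>) * (1 - \<alpha> * \<beta>)"
    by (simp add: max_def)
  then have "2 * c * drift \<alpha> \<beta> < 1 - \<alpha>"
    using \<open>\<alpha> * \<beta> < 1\<close> by (simp add: drift_def pos_divide_less_eq)
  then show ?thesis
    using \<open>K \<ge> 0\<close> unfolding K_def[symmetric] c_def by (simp add: pos_less_divide_eq algebra_simps)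
qed

theorem theorem4p3:
  fixes q \<alpha> \<beta> :: real and a\<^sub>1 a\<^sub>2 a\<^sub>3 a\<^sub>4 :: int
  assumes "q > 1"
    and "K_zeros q < \<infinity>"
    and "{a\<^sub>1, a\<^sub>2, a\<^sub>3, a\<^sub>4} \<subseteq> {0..\<lfloor>q\<rfloor>}"
    and "a\<^sub>1 \<le> min_limit_digit q" "a\<^sub>2 \<le> min_limit_digit q"
        "a\<^sub>3 \<le> min_limit_digit q" "a\<^sub>4 \<le> min_limit_digit q"
    and "\<alpha> \<in> {0<..<1}" and "\<beta> \<in> {0<..<1}"
    and "\<beta> > A_2q q \<alpha>"
    and "log q (\<alpha> * \<beta>) \<notin> \<rat>"
  shows "winning unit_cube \<alpha> \<beta>
    (digit_appears lipschitz_quat unit_cube (quat_of_real q)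
      (Quat (of_int a\<^sub>1) (of_int a\<^sub>2) (of_int a\<^sub>3) (of_int a\<^sub>4)))"
proof -
  interpret q_expansion q
    using assms(1) by unfold_locales
  define K where "K = the_enat (K_zeros q)"
  have K: "1 \<le> q ^ (K + 1) * left_orbit q k" for k
    unfolding K_def by (rule left_orbit_ge[OF assms(2)])
  have \<alpha>\<beta>: "0 < \<alpha>" "\<alpha> < 1" "0 < \<beta>" "\<beta> < 1"
    using assms by auto
  have g: "0 < \<alpha> * \<beta>" "\<alpha> * \<beta> < 1"
    using \<alpha>\<beta> mult_strict_mono[of \<alpha> 1 \<beta> 1] by auto
  define a :: "4 \<Rightarrow> int" where "a i = (vector [a\<^sub>1, a\<^sub>2, a\<^sub>3, a\<^sub>4] :: int ^ 4) $ i" for i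
  have a_nth: "a 1 = a\<^sub>1" "a 2 = a\<^sub>2" "a 3 = a\<^sub>3" "a 4 = a\<^sub>4"
    by (simp_all add: a_def vector_def)
  \<comment> \<open>Being at most d', each digit is below \<lfloor>q\<rfloor>, so its interval has
    full length in every full cylinder.\<close>
  have "\<forall>i. 0 \<le> a i \<and> a i < \<lfloor>q\<rfloor>"
    unfolding forall_4 a_nth using assms(3-7) min_limit_digit_less by auto
  then have a: "0 \<le> a i" "of_int (a i) + 1 \<le> q" for i
    by (simp, smt (verit, best) le_floor_iff of_int_1 of_int_add)
  have digit: "Quat (of_int a\<^sub>1) (of_int a\<^sub>2) (of_int a\<^sub>3) (of_int a\<^sub>4) = (\<chi> i. of_int (a i))"
    by (simp add: vec_eq_iff forall_4 a_nth)
  have drift_nonneg: "0 \<le> drift \<alpha> \<beta>"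
    using \<alpha>\<beta> g by (simp add: drift_def)
  have drift_less: "2 * q * drift \<alpha> \<beta> < (1 - \<alpha>) / (2 * (real K + 2))"
    unfolding K_def by (rule drift_less_if_A_2q_less[OF q_gt_1 \<alpha>\<beta> assms(10)])
  have hi_pos: "0 < (1 - \<alpha>) / (2 * (real K + 2))"
    using \<alpha>\<beta> by simp
  \<comment> \<open>From order \<open>N\<close> on the gap bound is at most 1/2, as
    \<open>full_cylinder_near\<close> requires.\<close>
  obtain N where N: "2 * (real K + 2) < q ^ N"
    using real_arch_pow q_gt_1 by blast
  show ?thesis
    unfolding digit
  proof (rule winning_by_approach[OF \<alpha>\<beta> convex_unit_cube])
    fix \<rho> :: real assume "\<rho> > 0"
    \<comment> \<open>\<open>lo\<close> lets the drift ball fit into the digit cubes inside full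
      cylinders of order \<open>j\<close>; \<open>hi\<close> brings such a cube's center within
      Alice's reach from any center of Bob.\<close>
    obtain n j where "N \<le> j" and lo: "2 * q * drift \<alpha> \<beta> * ((\<alpha> * \<beta>) ^ n * \<rho>) < 1 / q ^ j"
      and hi: "1 / q ^ j < (1 - \<alpha>) / (2 * (real K + 2)) * ((\<alpha> * \<beta>) ^ n * \<rho>)"
      by (rule ex_power_ratio_between[OF q_gt_1 g assms(11) \<open>\<rho> > 0\<close> drift_less hi_pos])
    define R where "R = game_radius \<alpha> \<beta> \<rho> n"
    have "0 \<le> R"
      using \<open>\<rho> > 0\<close> g by (simp add: R_def game_radius_def)
    have "q ^ N \<le> q ^ j"
      using \<open>N \<le> j\<close> q_gt_1 by (intro power_increasing) auto
    then have L: "(real K + 2) / q ^ j \<le> 1 / 2"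
      using N q_pos by (simp add: divide_simps)
    have "2 * q * (drift \<alpha> \<beta> * R) < 1 / q ^ j"
      using lo by (simp add: R_def game_radius_def mult.assoc)
    then have ball: "\<exists>p\<in>unit_cube. dist x p \<le> 2 * ((real K + 2) / q ^ j) \<and> cball p (drift \<alpha> \<beta> * R) \<subseteq>
        digit_appears lipschitz_quat unit_cube (quat_of_real q) (\<chi> i. of_int (a i))"
      if "x \<in> unit_cube" for x
      using drift_nonneg \<open>0 \<le> R\<close> that by (intro ball_in_digit_appears[OF K a _ L]) auto
    have "1 / q ^ j * (2 * (real K + 2)) \<le> (1 - \<alpha>) / (2 * (real K + 2)) * R * (2 * (real K + 2))"
      using hi by (intro mult_right_mono) (auto simp: R_def game_radius_def)
    then have "2 * ((real K + 2) / q ^ j) \<le> (1 - \<alpha>) * R"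
      by (simp add: mult.commute)
    then show "\<exists>n. \<forall>x\<in>unit_cube. \<exists>p\<in>unit_cube. dist x p \<le> (1 - \<alpha>) * game_radius \<alpha> \<beta> \<rho> n \<and>
        cball p (drift \<alpha> \<beta> * game_radius \<alpha> \<beta> \<rho> n) \<subseteq>
        digit_appears lipschitz_quat unit_cube (quat_of_real q) (\<chi> i. of_int (a i))"
      using ball unfolding R_def by (intro exI[of _ n]) (meson order_trans)
  qed (auto simp: digit_appears_def)
qed

end
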